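(* For each $n\ge1$ let $p_n\in(0,1)$ with $p_n\to0$, let $X_1,\dots,X_n$ be i.i.d. $\mathrm{Ber}(p_n)$, let $G_n$ be a simple undirected graph on vertex set $\{1,\dots,n\}$ with adjacency matrix $(a_{uv}(G_n))$, and let $T_n:=\frac12\sum_{1\le u,v\le n}a_{uv}(G_n)X_uX_v$. Suppose $\mathbb E[T_n]=|E(G_n)|p_n^2=\Theta(1)$ and $T_n$ converges in distribution to a random variable $T$. Then $T\stackrel{D}{=}J+J_0$, where the law of $J$ belongs to $\overline{\mathcal P}(\mathcal W,\mathcal F)$, $J_0\sim\mathrm{Pois}(\lambda)$ for some $\lambda\ge0$, and $J_0$ is independent of $J$.
   Context: $\Theta(1)$ means bounded above and below by positive constants for all large $n$. $\mathrm{Pois}(0)$ is the point mass at $0$. $\mathcal W$ is the set of symmetric measurable functions $[0,\infty)^2\to[0,1]$; $\mathcal F$ is the set of functions $d:[0,\infty)\to[0,\infty)$ in $L_1([0,\infty))$. $\mathcal P(\mathcal W,\mathcal F)$ is the collection of all probability measures $\mu$ on the non-negative integers such that, if $J\sim\mu$, then $J\stackrel{D}{=}J_1+J_2$, where for $t_1,t_2\ge0$ $$\mathbb E\exp\{-t_1J_1-t_2J_2\}=\mathbb E\exp\left\{\frac12\int_0^\infty\int_0^\infty\phi_{W,t_1}(x,y)\,dN(x)\,dN(y)-(1-e^{-t_2})\int_0^\infty\Delta(x)\,dN(x)\right\}$$ for some $W\in\mathcal W$ with $\int_0^\infty\int_0^\infty W(x,y)\,dx\,dy<\infty$ and some $d\in\mathcal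 F$ such that $\Delta(x):=d(x)-\int_0^\infty W(x,y)\,dy\ge0$ for all $x\in[0,\infty)$. Here $\phi_{W,t_1}(x,y):=\log(1-W(x,y)+W(x,y)e^{-t_1})$ and $\{N(t),t\ge0\}$ is a homogeneous Poisson process of rate $1$. $\overline{\mathcal P}(\mathcal W,\mathcal F)$ is the closure of $\mathcal P(\mathcal W,\mathcal F)$ under weak convergence, i.e. the set of probability measures on the non-negative integers that are weak limits of sequences in $\mathcal P(\mathcal W,\mathcal F)$. Stochastic integrals: let $N(A)$ be the number of points of the rate-1 Poisson process in the Borel set $A\subseteq[0,\infty)$. If $f=\sum_{i_1,\dots,i_k=1}^m a_{i_1\dots i_k}\mathbf 1_{A_{i_1}\times\cdots\times A_{i_k}}\in L_1([0,\infty)^k)$ with $A_1,\dots,A_m$ pairwise disjoint Borel sets and $a_{i_1\dots i_k}=0$ whenever two indices coincide, then $\int f\prod_j dN(x_j):=\sum a_{i_1\dots i_k}N(A_{i_1})\cdots N(A_{i_k})$. For general $f\in L_1([0,\infty)^k)$ the integral is the $L_1(\Omega)$-limit of the integrals of any sequence of such elementary functions converging to $f$ in $L_1$ (the limit exists and does not depend on the sequence). *)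

theory Defs
  imports "HOL-Probability.Probability" "HOL-Library.Landau_Symbols"
begin

section \<open>The rate-1 Poisson process on the half-line\<close>

abbreviation halfline :: "real measure" where
  "halfline \<equiv> restrict_space lborel {0..}"

abbreviation quadrant :: "(real \<times> real) measure" where
  "quadrant \<equiv> halfline \<Otimes>\<^sub>M halfline"

text \<open>The library constant \<^const>\<open>poisson_pmf\<close> is only specified for a positive rate.\<close>

definition pois :: "real \<Rightarrow> nat pmf" where
  "pois r = (if r = 0 then return_pmf 0 else poisson_pmf r)"

text \<open>The process is given by its random, locally finite set of points; the number of points
  in \<open>A\<close> is \<open>num_points pts A\<close>. As \<^const>\<open>card\<close> is \<open>0\<close> on infinite sets, this is meaningful
  only when \<open>A\<close> contains finitely many points, which is almost surely the case when \<open>A\<close> has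
  finite Lebesgue measure.\<close>

definition num_points :: "('w \<Rightarrow> real set) \<Rightarrow> real set \<Rightarrow> 'w \<Rightarrow> nat" where
  "num_points pts A \<omega> = card (pts \<omega> \<inter> A)"

definition finite_borel :: "real set \<Rightarrow> bool" where
  "finite_borel A \<longleftrightarrow> A \<in> sets borel \<and> A \<subseteq> {0..} \<and> emeasure lborel A < \<infinity>"

locale poisson_process = prob_space P for P :: "'w measure" +
  fixes pts :: "'w \<Rightarrow> real set"
  assumes points_nonneg: "\<And>\<omega>. \<omega> \<in> space P \<Longrightarrow> pts \<omega> \<subseteq> {0..}"
    and locally_finite: "\<And>\<omega> t. \<omega> \<in> space P \<Longrightarrow> finite (pts \<omega> \<inter> {0..t})"
    and measurable_num_points:
      "\<And>A. finite_borel A \<Longrightarrow> num_points pts A \<in> measurable P (count_space UNIV)"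
    and distr_num_points:
      "\<And>A. finite_borel A \<Longrightarrow>
         distr P (count_space UNIV) (num_points pts A) = measure_pmf (pois (measure lborel A))"
    and indep_num_points:
      "\<And>(A :: nat \<Rightarrow> real set) I. \<lbrakk>finite I; \<And>i. i \<in> I \<Longrightarrow> finite_borel (A i); disjoint_family_on A I\<rbrakk> \<Longrightarrow>
         indep_vars (\<lambda>_. count_space UNIV) (\<lambda>i. num_points pts (A i)) I"

section \<open>Stochastic integrals with respect to the Poisson process\<close>

definition L1_limit :: "'a measure \<Rightarrow> (nat \<Rightarrow> 'a \<Rightarrow> real) \<Rightarrow> ('a \<Rightarrow> real) \<Rightarrow> bool" where
  "L1_limit M F f \<longleftrightarrow> (\<forall>n. integrable M (F n)) \<and> integrable M f \<and>
     (\<lambda>n. LINT x|M. \<bar>F n x - f x\<bar>) \<longlonglongrightarrow> 0"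

definition disjoint_borel :: "nat \<Rightarrow> (nat \<Rightarrow> real set) \<Rightarrow> bool" where
  "disjoint_borel m A \<longleftrightarrow>
     (\<forall>i<m. A i \<in> sets borel \<and> A i \<subseteq> {0..}) \<and> disjoint_family_on A {..<m}"

text \<open>In the next two definitions \<open>F\<close> ranges over sequences of elementary integrands and \<open>G\<close>
  gives the integrals of these integrands. Membership of the elementary functions in
  \<open>L\<^sub>1\<close> is part of \<^const>\<open>L1_limit\<close>. The limit \<open>I\<close> exists, and does not depend on the
  approximating sequence up to almost sure equality.\<close>

definition is_stoch_integral1 ::
  "'w measure \<Rightarrow> ('w \<Rightarrow> real set) \<Rightarrow> (real \<Rightarrow> real) \<Rightarrow> ('w \<Rightarrow> real) \<Rightarrow> bool" where
  "is_stoch_integral1 P pts f I \<longleftrightarrow>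
     (\<exists>(m :: nat \<Rightarrow> nat) (A :: nat \<Rightarrow> nat \<Rightarrow> real set) (a :: nat \<Rightarrow> nat \<Rightarrow> real) F G.
        (\<forall>n. disjoint_borel (m n) (A n)) \<and>
        (\<forall>n. F n = (\<lambda>x. \<Sum>i<m n. a n i * indicator (A n i) x)) \<and>
        (\<forall>n. G n = (\<lambda>\<omega>. \<Sum>i<m n. a n i * real (num_points pts (A n i) \<omega>))) \<and>
        L1_limit halfline F f \<and> L1_limit P G I)"

definition is_stoch_integral2 ::
  "'w measure \<Rightarrow> ('w \<Rightarrow> real set) \<Rightarrow> (real \<Rightarrow> real \<Rightarrow> real) \<Rightarrow> ('w \<Rightarrow> real) \<Rightarrow> bool" where
  "is_stoch_integral2 P pts f I \<longleftrightarrow>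
     (\<exists>(m :: nat \<Rightarrow> nat) (A :: nat \<Rightarrow> nat \<Rightarrow> real set) (a :: nat \<Rightarrow> nat \<Rightarrow> nat \<Rightarrow> real) F G.
        (\<forall>n. disjoint_borel (m n) (A n) \<and> (\<forall>i<m n. a n i i = 0)) \<and>
        (\<forall>n. F n = (\<lambda>(x, y). \<Sum>i<m n. \<Sum>j<m n. a n i j * indicator (A n i) x * indicator (A n j) y)) \<and>
        (\<forall>n. G n = (\<lambda>\<omega>. \<Sum>i<m n. \<Sum>j<m n.
               a n i j * real (num_points pts (A n i) \<omega>) * real (num_points pts (A n j) \<omega>))) \<and>
        L1_limit quadrant F (\<lambda>(x, y). f x y) \<and> L1_limit P G I)"

section \<open>The classes of limit laws\<close>

definition W_class :: "(real \<Rightarrow> real \<Rightarrow> real) set" where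
  "W_class = {W. (\<lambda>(x, y). W x y) \<in> borel_measurable quadrant \<and>
     (\<forall>x\<ge>0. \<forall>y\<ge>0. W x y = W y x \<and> 0 \<le> W x y \<and> W x y \<le> 1)}"

definition F_class :: "(real \<Rightarrow> real) set" where
  "F_class = {d. integrable halfline d \<and> (\<forall>x\<ge>0. 0 \<le> d x)}"

definition phi :: "(real \<Rightarrow> real \<Rightarrow> real) \<Rightarrow> real \<Rightarrow> real \<Rightarrow> real \<Rightarrow> real" where
  "phi W t x y = ln (1 - W x y + W x y * exp (- t))"

definition Delta :: "(real \<Rightarrow> real \<Rightarrow> real) \<Rightarrow> (real \<Rightarrow> real) \<Rightarrow> real \<Rightarrow> real" where
  "Delta W d x = d x - (LINT y|halfline. W x y)"

text \<open>Below, \<open>\<rho>\<close> is the joint law of \<open>(J\<^sub>1, J\<^sub>2)\<close>. The integrability of every section \<open>W x\<close> is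
  implicit in \<open>Delta W d x \<ge> 0\<close>; it is spelled out because the Bochner integral of a
  non-integrable function is \<open>0\<close>.\<close>

definition P_class :: "'w measure \<Rightarrow> ('w \<Rightarrow> real set) \<Rightarrow> nat pmf set" where
  "P_class P pts = {\<mu>. \<exists>\<rho> :: (nat \<times> nat) pmf. \<exists>W\<in>W_class. \<exists>d\<in>F_class.
     \<mu> = map_pmf (\<lambda>(j1, j2). j1 + j2) \<rho> \<and>
     integrable quadrant (\<lambda>(x, y). W x y) \<and>
     (\<forall>x\<ge>0. integrable halfline (W x) \<and> Delta W d x \<ge> 0) \<and>
     (\<forall>t1\<ge>0. \<forall>t2\<ge>0. \<exists>I1 I2.
        is_stoch_integral2 P pts (phi W t1) I1 \<and>
        is_stoch_integral1 P pts (Delta W d) I2 \<and>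
        measure_pmf.expectation \<rho> (\<lambda>(j1, j2). exp (- t1 * real j1 - t2 * real j2)) =
        (LINT \<omega>|P. exp (1/2 * I1 \<omega> - (1 - exp (- t2)) * I2 \<omega>)))}"

definition real_law :: "nat pmf \<Rightarrow> real measure" where
  "real_law \<mu> = distr (measure_pmf \<mu>) borel real"

definition P_closure :: "'w measure \<Rightarrow> ('w \<Rightarrow> real set) \<Rightarrow> nat pmf set" where
  "P_closure P pts = {\<mu>. \<exists>\<nu> :: nat \<Rightarrow> nat pmf. (\<forall>k. \<nu> k \<in> P_class P pts) \<and>
     weak_conv_m (\<lambda>k. real_law (\<nu> k)) (real_law \<mu>)}"

section \<open>Random edge counts\<close>

definition is_simple_graph :: "nat \<Rightarrow> nat set set \<Rightarrow> bool" where
  "is_simple_graph n E \<longleftrightarrow> (\<forall>e\<in>E. e \<subseteq> {1..n} \<and> card e = 2)"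

definition adj :: "nat set set \<Rightarrow> nat \<Rightarrow> nat \<Rightarrow> real" where
  "adj E u v = (if {u, v} \<in> E then 1 else 0)"

definition edge_count :: "nat \<Rightarrow> nat set set \<Rightarrow> (nat \<Rightarrow> 'a \<Rightarrow> real) \<Rightarrow> 'a \<Rightarrow> real" where
  "edge_count n E X \<omega> = 1/2 * (\<Sum>u=1..n. \<Sum>v=1..n. adj E u v * X u \<omega> * X v \<omega>)"

definition iid_bernoulli :: "'a measure \<Rightarrow> nat \<Rightarrow> real \<Rightarrow> (nat \<Rightarrow> 'a \<Rightarrow> real) \<Rightarrow> bool" where
  "iid_bernoulli M n q X \<longleftrightarrow> prob_space.indep_vars M (\<lambda>_. borel) X {1..n} \<and>
     (\<forall>u\<in>{1..n}. distr M borel (X u) = distr (measure_pmf (bernoulli_pmf q)) borel of_bool)"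

end

theory Submission
  imports Defs
begin

text \<open>
  No separate Poisson component is needed: \<open>T\<close> itself lies in the closure, so \<open>\<lambda> = 0\<close> works.
  Let \<open>W\<close> be the 0-1 valued graphon on \<open>[0, (n + 1) p)\<^sup>2\<close> given by the adjacency matrix of
  \<open>G\<close> on blocks of side length \<open>p\<close>, and choose \<open>d\<close> such that \<open>\<Delta> = 0\<close>. Then
  \<open>\<phi> = - t W\<close> is elementary, and the member of \<open>P(W, F)\<close> it defines is the law of
  \<open>J = \<Sum> N\<^sub>u N\<^sub>v\<close> over the edges \<open>uv\<close>, where the \<open>N\<^sub>u\<close> are the independent \<open>Pois(p)\<close> numbers
  of points in the blocks. Coupling \<open>N\<^sub>u\<close> with \<open>X\<^sub>u\<close> such that \<open>N\<^sub>u > 0\<close> implies \<open>X\<^sub>u = 1\<close> and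
  \<open>N\<^sub>u \<noteq> X\<^sub>u\<close> has probability at most \<open>p\<^sup>2\<close>, each edge contributes to \<open>J \<noteq> T\<close> with
  probability at most \<open>2 p\<^sup>3\<close>, whence the total variation distance of \<open>J\<close> and \<open>T\<close> is at most
  \<open>2 p E[T]\<close>, which tends to \<open>0\<close>.
\<close>

section \<open>Preliminaries on independent families and on the mean of the Poisson law\<close>

text \<open>Independence makes each joint law the product of its marginals, so equal marginals force
  equal laws of every measurable function \<open>g\<close>. This moves edge counts between different
  probability spaces.\<close>

lemma distr_indep_vars_cong:
  assumes M: "prob_space M" "prob_space M2" and I: "I \<noteq> {}"
    and X: "prob_space.indep_vars M N X I" and Y: "prob_space.indep_vars M2 N Y I"
    and marg: "\<And>i. i \<in> I \<Longrightarrow> distr M (N i) (X i) = distr M2 (N i) (Y i)"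
    and g: "g \<in> measurable (PiM I N) L"
  shows "distr M L (\<lambda>\<omega>. g (\<lambda>i\<in>I. X i \<omega>)) = distr M2 L (\<lambda>\<omega>. g (\<lambda>i\<in>I. Y i \<omega>))"
proof -
  interpret M: prob_space M by fact
  interpret M2: prob_space M2 by fact
  have [measurable]: "X i \<in> measurable M (N i)" "Y i \<in> measurable M2 (N i)" if "i \<in> I" for i
    using X Y that unfolding M.indep_vars_def M2.indep_vars_def by auto
  have "distr M L (\<lambda>\<omega>. g (\<lambda>i\<in>I. X i \<omega>)) = distr (distr M (PiM I N) (\<lambda>\<omega>. \<lambda>i\<in>I. X i \<omega>)) L g"
    by (subst distr_distr[OF g]) (auto simp: comp_def)
  also have "distr M (PiM I N) (\<lambda>\<omega>. \<lambda>i\<in>I. X i \<omega>) = PiM I (\<lambda>i. distr M (N i) (X i))"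
    using M.indep_vars_iff_distr_eq_PiM'[OF I, of X N] X by simp
  also have "\<dots> = PiM I (\<lambda>i. distr M2 (N i) (Y i))"
    by (intro PiM_cong refl marg)
  also have "\<dots> = distr M2 (PiM I N) (\<lambda>\<omega>. \<lambda>i\<in>I. Y i \<omega>)"
    using M2.indep_vars_iff_distr_eq_PiM'[OF I, of Y N] Y by simp
  also have "distr \<dots> L g = distr M2 L (\<lambda>\<omega>. g (\<lambda>i\<in>I. Y i \<omega>))"
    by (subst distr_distr[OF g]) (auto simp: comp_def)
  finally show ?thesis .
qed

lemma integrable_poisson_pmf_real:
  assumes "0 < r"
  shows "integrable (measure_pmf (poisson_pmf r)) real"
proof -
  \<comment> \<open>Shifting the index by one turns the series of the mean into \<open>r\<close>
    times the exponential series.\<close>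
  have "(\<lambda>k. r * (r ^ k / fact k)) = (\<lambda>k. real (Suc k) * (r ^ Suc k / fact (Suc k)))"
    by (rule ext) (simp add: field_simps del: of_nat_Suc)
  moreover have "summable (\<lambda>k. r * (r ^ k / fact k))"
    using summable_exp[of r] by (intro summable_mult) (simp add: field_simps)
  ultimately have "summable (\<lambda>k. real k * (r ^ k / fact k))"
    by (subst summable_Suc_iff [symmetric]) (simp only:)
  from summable_mult2[OF this, of "exp (- r)"]
  have "summable (\<lambda>k. \<bar>pmf (poisson_pmf r) k * real k\<bar>)"
    using assms by (simp add: mult_ac)
  thus ?thesis
    by (subst measure_pmf_eq_density)
       (simp add: integrable_real_density integrable_count_space_nat_iff)
qed

section \<open>Counting edges\<close>

text \<open>The orientation \<open>u < v\<close> picks one representative of each edge, so sums over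
  this set need no factor 1/2.\<close>

definition edge_pairs :: "nat set set \<Rightarrow> (nat \<times> nat) set" where
  "edge_pairs E = {(u, v). u < v \<and> {u, v} \<in> E}"

lemma edge_pairs_subset:
  assumes "is_simple_graph n E"
  shows "edge_pairs E \<subseteq> {1..n} \<times> {1..n}"
  using assms unfolding edge_pairs_def is_simple_graph_def by fastforce

lemma finite_edge_pairs: "is_simple_graph n E \<Longrightarrow> finite (edge_pairs E)"
  using edge_pairs_subset by (rule finite_subset) auto

lemma adj_commute: "adj E u v = adj E v u"
  by (simp add: adj_def insert_commute)

lemma adj_self: "is_simple_graph n E \<Longrightarrow> adj E u u = 0"
  unfolding adj_def is_simple_graph_def by force

text \<open>The diagonal contributes nothing, and the remaining adjacent pairs split into
  \<open>edge_pairs E\<close> and its mirror image, which have equal sums. The index set may exceed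
  \<open>{1..n}\<close> because blocks will be numbered from 0.\<close>

lemma half_adj_sum:
  assumes E: "is_simple_graph n E" and I: "finite I" "{1..n} \<subseteq> I"
  shows "1/2 * (\<Sum>u\<in>I. \<Sum>v\<in>I. adj E u v * x u * x v) = (\<Sum>(u, v)\<in>edge_pairs E. x u * x v)"
proof -
  let ?D = "edge_pairs E" and ?f = "\<lambda>(u, v). x u * x v :: real"
  have D: "?D \<subseteq> I \<times> I" using edge_pairs_subset[OF E] I by auto
  have fin: "finite ?D" by (rule finite_edge_pairs[OF E])
  have "(\<Sum>u\<in>I. \<Sum>v\<in>I. adj E u v * x u * x v) = (\<Sum>(u, v)\<in>I \<times> I. adj E u v * x u * x v)"
    by (simp add: sum.cartesian_product)
  also have "\<dots> = (\<Sum>(u, v)\<in>?D \<union> prod.swap ` ?D. adj E u v * x u * x v)"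
  proof (rule sum.mono_neutral_right)
    show "?D \<union> prod.swap ` ?D \<subseteq> I \<times> I" using D by auto
    show "\<forall>z\<in>I \<times> I - (?D \<union> prod.swap ` ?D). (case z of (u, v) \<Rightarrow> adj E u v * x u * x v) = 0"
    proof (rule ballI)
      fix z assume z: "z \<in> I \<times> I - (?D \<union> prod.swap ` ?D)"
      obtain u v where uv: "z = (u, v)" by (cases z)
      have "\<not> (u < v \<and> {u, v} \<in> E)" "\<not> (v < u \<and> {v, u} \<in> E)"
        using z uv by (auto simp: edge_pairs_def image_iff)
      thus "(case z of (u, v) \<Rightarrow> adj E u v * x u * x v) = 0"
        using uv adj_self[OF E, of u] by (cases u v rule: linorder_cases) (auto simp: adj_def insert_commute)
    qed
  qed (use I in auto)
  also have "\<dots> = (\<Sum>(u, v)\<in>?D \<union> prod.swap ` ?D. x u * x v)"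
    by (intro sum.cong) (auto simp: edge_pairs_def adj_def insert_commute)
  also have "\<dots> = (\<Sum>z\<in>?D. ?f z) + (\<Sum>z\<in>prod.swap ` ?D. ?f z)"
    by (rule sum.union_disjoint) (use fin in \<open>auto simp: edge_pairs_def\<close>)
  also have "(\<Sum>z\<in>prod.swap ` ?D. ?f z) = (\<Sum>z\<in>?D. ?f z)"
    by (subst sum.reindex) (auto simp: comp_def case_prod_beta mult.commute)
  finally show ?thesis by simp
qed

section \<open>Coupling the edge counts\<close>

text \<open>A coupling of \<open>Pois(p)\<close> and \<open>Ber(p)\<close> whose second component is \<open>True\<close> whenever the
  first is positive; the parameter used when \<open>k = 0\<close> makes the second marginal exact.\<close>

definition pois_bernoulli :: "real \<Rightarrow> (nat \<times> bool) pmf" where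
  "pois_bernoulli p = bind_pmf (poisson_pmf p) (\<lambda>k. map_pmf (Pair k)
     (if k = 0 then bernoulli_pmf (1 - (1 - p) * exp p) else return_pmf True))"

context
  fixes p :: real
  assumes p: "0 < p" "p < 1"
begin

text \<open>The parameter is a probability because 1 - p is at most exp (- p).\<close>

lemma coupling_param: "0 \<le> 1 - (1 - p) * exp p" "1 - (1 - p) * exp p \<le> 1"
proof -
  have "1 - p \<le> exp (- p)" using exp_ge_add_one_self[of "- p"] by simp
  hence "(1 - p) * exp p \<le> exp (- p) * exp p" by (intro mult_right_mono) auto
  thus "0 \<le> 1 - (1 - p) * exp p" by (simp add: mult_exp_exp)
qed (use p in auto)

lemma map_fst_pois_bernoulli: "map_pmf fst (pois_bernoulli p) = poisson_pmf p"
  by (simp add: pois_bernoulli_def map_bind_pmf map_pmf_comp bind_return_pmf')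

lemma map_snd_pois_bernoulli: "map_pmf snd (pois_bernoulli p) = bernoulli_pmf p"
proof -
  let ?q = "1 - (1 - p) * exp p"
  let ?B = "\<lambda>k::nat. if k = 0 then bernoulli_pmf ?q else return_pmf True"
  have "map_pmf snd (pois_bernoulli p) = bind_pmf (poisson_pmf p) ?B"
    by (simp add: pois_bernoulli_def map_bind_pmf map_pmf_comp)
  \<comment> \<open>\<open>False\<close> arises only from \<open>k = 0\<close>, which has mass exp
    (- p), and then with conditional probability (1 - p) exp p.\<close>
  also have "pmf \<dots> False = measure_pmf.expectation (poisson_pmf p) (\<lambda>k. (1 - ?q) * indicator {0} k)"
    unfolding pmf_bind using coupling_param by (intro Bochner_Integration.integral_cong) auto
  also have "\<dots> = (1 - p) * (exp p * exp (- p))"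
    using p by (simp add: measure_pmf_single)
  also have "\<dots> = pmf (bernoulli_pmf p) False"
    using p by (simp add: mult_exp_exp)
  finally have *: "pmf (map_pmf snd (pois_bernoulli p)) False = pmf (bernoulli_pmf p) False" .
  \<comment> \<open>A law on \<open>bool\<close> is determined by its mass at
    \<open>False\<close>.\<close>
  have "pmf q True = 1 - pmf q False" for q :: "bool pmf"
    using pmf_False_conv_True[of q] by simp
  with * show ?thesis by (intro pmf_eqI) (metis (full_types))
qed

text \<open>The components agree only at \<open>(0, False)\<close>, of mass 1 - p, and at
  \<open>(1, True)\<close>, of mass p exp (- p). What remains is p (1 - exp (- p)), at most the
  square of p.\<close>

lemma prob_pois_bernoulli_neq:
  "measure_pmf.prob (pois_bernoulli p) {(k, b). k \<noteq> of_bool b} \<le> p\<^sup>2"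
proof -
  let ?q = "1 - (1 - p) * exp p"
  have 0: "pmf (pois_bernoulli p) (0, False) = 1 - p"
  proof -
    have "pmf (pois_bernoulli p) (0, False) =
        measure_pmf.expectation (poisson_pmf p) (\<lambda>k. (1 - ?q) * indicator {0} k)"
      unfolding pmf_bind pois_bernoulli_def using coupling_param
      by (intro Bochner_Integration.integral_cong)
         (auto simp: pmf_map_inj' inj_on_def pmf_map_outside image_iff pmf_eq_0_set_pmf indicator_def)
    thus ?thesis using p by (simp add: measure_pmf_single mult_exp_exp)
  qed
  have 1: "pmf (pois_bernoulli p) (1, True) = p * exp (- p)"
  proof -
    have "pmf (pois_bernoulli p) (1, True) =
        measure_pmf.expectation (poisson_pmf p) (indicator {1})"
      unfolding pmf_bind pois_bernoulli_def
      by (intro Bochner_Integration.integral_cong)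
         (auto simp: pmf_map_inj' inj_on_def pmf_map_outside image_iff pmf_eq_0_set_pmf indicator_def)
    thus ?thesis using p by (simp add: measure_pmf_single)
  qed
  have "{(k, b). k \<noteq> of_bool b} = - {(0, False), (1::nat, True)}"
    by (auto simp: of_bool_def split: if_splits)
  hence "measure_pmf.prob (pois_bernoulli p) {(k, b). k \<noteq> of_bool b} =
      1 - measure_pmf.prob (pois_bernoulli p) {(0, False), (1, True)}"
    by (simp add: Compl_eq_Diff_UNIV measure_pmf.prob_compl[symmetric])
  also have "\<dots> = p - p * exp (- p)"
    using 0 1 by (simp add: measure_measure_pmf_finite)
  also have "\<dots> = p * (1 - exp (- p))" by (simp add: algebra_simps)
  also have "\<dots> \<le> p * p"
    using p exp_ge_add_one_self[of "- p"] by (intro mult_left_mono) auto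
  finally show ?thesis by (simp add: power2_eq_square)
qed

lemma pois_bernoulli_support: "(k, b) \<in> set_pmf (pois_bernoulli p) \<Longrightarrow> k > 0 \<Longrightarrow> b"
  by (auto simp: pois_bernoulli_def split: if_splits)

end

text \<open>A function of vertex values alone, so that one polynomial serves the given Bernoulli
  variables, both components of the coupling and the block counts.\<close>

definition edge_poly :: "nat set set \<Rightarrow> (nat \<Rightarrow> real) \<Rightarrow> real" where
  "edge_poly E x = (\<Sum>(u, v)\<in>edge_pairs E. x u * x v)"

lemma edge_count_eq_edge_poly:
  "is_simple_graph n E \<Longrightarrow> edge_count n E X \<omega> = edge_poly E (\<lambda>u. X u \<omega>)"
  unfolding edge_count_def edge_poly_def by (rule half_adj_sum) auto

lemma edge_poly_restrict:
  assumes "is_simple_graph n E"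
  shows "edge_poly E (\<lambda>u\<in>{1..n}. x u) = edge_poly E x"
  unfolding edge_poly_def using edge_pairs_subset[OF assms] by (intro sum.cong) auto

lemma measurable_edge_poly:
  assumes "is_simple_graph n E"
  shows "edge_poly E \<in> borel_measurable (PiM {1..n} (\<lambda>_. borel))"
  unfolding edge_poly_def case_prod_beta using edge_pairs_subset[OF assms]
  by (intro borel_measurable_sum borel_measurable_times measurable_component_singleton) auto

lemma distr_edge_poly_cong:
  assumes E: "is_simple_graph n E" and "prob_space M" "prob_space M2" "n \<ge> 1"
    and "prob_space.indep_vars M (\<lambda>_. borel) X {1..n}"
    and "prob_space.indep_vars M2 (\<lambda>_. borel) Y {1..n}"
    and "\<And>u. u \<in> {1..n} \<Longrightarrow> distr M borel (X u) = distr M2 borel (Y u)"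
  shows "distr M borel (\<lambda>\<omega>. edge_poly E (\<lambda>u. X u \<omega>)) =
    distr M2 borel (\<lambda>\<omega>. edge_poly E (\<lambda>u. Y u \<omega>))"
proof -
  have "{1..n} \<noteq> {}" using \<open>n \<ge> 1\<close> by simp
  from distr_indep_vars_cong[OF assms(2,3) this assms(5-7) measurable_edge_poly[OF E]]
  show ?thesis by (simp only: edge_poly_restrict[OF E])
qed

lemma distr_measure_pmf_comp:
  "distr (measure_pmf q) borel (\<lambda>x. g (h x)) = distr (measure_pmf (map_pmf h q)) borel g"
  by (simp add: map_pmf_rep_eq distr_distr comp_def)

lemma measure_Pi_pmf_two:
  assumes "finite I" "u \<in> I" "v \<in> I" "u \<noteq> v"
  shows "measure_pmf.prob (Pi_pmf I d (\<lambda>_. q)) {f. f u \<in> A \<and> f v \<in> B} =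
    measure_pmf.prob q A * measure_pmf.prob q B"
proof -
  \<comment> \<open>The event is a product set whose other factors are \<open>UNIV\<close>, so all
    but two factors of its probability are 1.\<close>
  let ?C = "\<lambda>x. if x = u then A else if x = v then B else UNIV"
  have "{f. f u \<in> A \<and> f v \<in> B} = Pi I ?C"
    using assms by (auto simp: Pi_def)
  also have "measure_pmf.prob (Pi_pmf I d (\<lambda>_. q)) \<dots> = (\<Prod>x\<in>I. measure_pmf.prob q (?C x))"
    using assms by (simp add: measure_Pi_pmf_Pi)
  also have "\<dots> = (\<Prod>x\<in>{u, v}. measure_pmf.prob q (?C x))"
    using assms by (intro prod.mono_neutral_right) auto
  finally show ?thesis using assms by simp
qed

definition coupled :: "nat \<Rightarrow> real \<Rightarrow> (nat \<Rightarrow> nat \<times> bool) pmf" where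
  "coupled n p = Pi_pmf {1..n} (0, False) (\<lambda>_. pois_bernoulli p)"

abbreviation coupled_pois :: "nat \<Rightarrow> (nat \<Rightarrow> nat \<times> bool) \<Rightarrow> real" where
  "coupled_pois u f \<equiv> real (fst (f u))"

abbreviation coupled_bern :: "nat \<Rightarrow> (nat \<Rightarrow> nat \<times> bool) \<Rightarrow> real" where
  "coupled_bern u f \<equiv> of_bool (snd (f u))"

lemma indep_coupled:
  "prob_space.indep_vars (coupled n p) (\<lambda>_. borel) (\<lambda>u f. h (f u)) {1..n}"
  unfolding coupled_def
  by (intro prob_space.indep_vars_compose2[OF _ indep_vars_Pi_pmf] measure_pmf.prob_space_axioms) auto

lemma distr_coupled:
  "u \<in> {1..n} \<Longrightarrow> distr (coupled n p) borel (\<lambda>f. h (f u)) = distr (pois_bernoulli p) borel h"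
  by (simp add: distr_measure_pmf_comp[where h = "\<lambda>f. f u"] coupled_def Pi_pmf_component)

text \<open>Replaces the given space by the coupling, whose Bernoulli components have the same joint
  law as the variables \<open>X u\<close>.\<close>

lemma edge_count_law:
  assumes E: "is_simple_graph n E" and n: "n \<ge> 1" and p: "0 < p" "p < 1"
    and M: "prob_space M" and X: "iid_bernoulli M n p X"
  shows "distr M borel (edge_count n E X) =
    distr (coupled n p) borel (\<lambda>f. edge_poly E (\<lambda>u. coupled_bern u f))"
proof -
  have "distr M borel (X u) = distr (coupled n p) borel (coupled_bern u)" if "u \<in> {1..n}" for u
    using X that distr_coupled[OF that, of p "\<lambda>z. of_bool (snd z) :: real"]
    by (simp add: iid_bernoulli_def distr_measure_pmf_comp map_snd_pois_bernoulli p)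
  moreover have "edge_count n E X = (\<lambda>\<omega>. edge_poly E (\<lambda>u. X u \<omega>))"
    by (rule ext) (rule edge_count_eq_edge_poly[OF E])
  ultimately show ?thesis
    using X by (simp only: iid_bernoulli_def)
      (intro distr_edge_poly_cong[OF E M measure_pmf.prob_space_axioms n _ indep_coupled], auto)
qed

lemma prob_coupled_bern:
  assumes "0 < p" "p < 1"
  shows "measure_pmf.prob (pois_bernoulli p) {z. snd z} = p"
proof -
  have "measure_pmf.prob (pois_bernoulli p) {z. snd z} =
      measure_pmf.prob (map_pmf snd (pois_bernoulli p)) {True}"
    by (simp add: measure_map_pmf vimage_def)
  thus ?thesis using assms by (simp add: map_snd_pois_bernoulli measure_pmf_single)
qed

text \<open>Linearity and the independence of the two endpoints of an edge. The formula is what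
  converts the bound of the coupling into a multiple of the mean.\<close>

lemma expectation_edge_count:
  fixes p :: real
  assumes E: "is_simple_graph n E" and n: "n \<ge> 1" and p: "0 < p" "p < 1"
    and M: "prob_space M" and X: "iid_bernoulli M n p X"
  shows "prob_space.expectation M (edge_count n E X) = card (edge_pairs E) * p\<^sup>2"
proof -
  interpret M: prob_space M by fact
  \<comment> \<open>Only the variables with index in \<open>{1..n}\<close> are known to be
    measurable, so the count is first written through their restriction.\<close>
  have "edge_count n E X = (\<lambda>\<omega>. edge_poly E (\<lambda>u\<in>{1..n}. X u \<omega>))"
    by (rule ext) (simp only: edge_count_eq_edge_poly[OF E] edge_poly_restrict[OF E])
  moreover have [measurable]: "X u \<in> borel_measurable M" if "u \<in> {1..n}" for u
    using X that unfolding iid_bernoulli_def M.indep_vars_def by auto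
  ultimately have meas: "edge_count n E X \<in> borel_measurable M"
    using measurable_edge_poly[OF E] by (auto intro!: measurable_compose[OF measurable_restrict])
  have "M.expectation (edge_count n E X) = integral\<^sup>L (distr M borel (edge_count n E X)) (\<lambda>x. x)"
    using meas by (subst integral_distr) auto
  also have "\<dots> = measure_pmf.expectation (coupled n p) (\<lambda>f. edge_poly E (\<lambda>u. coupled_bern u f))"
    unfolding edge_count_law[OF assms] by (subst integral_distr) auto
  also have "\<dots> = (\<Sum>(u, v)\<in>edge_pairs E. measure_pmf.expectation (coupled n p)
      (\<lambda>f. coupled_bern u f * coupled_bern v f))"
    unfolding edge_poly_def case_prod_beta
    by (intro Bochner_Integration.integral_sum measure_pmf.integrable_const_bound[where B = 1]) auto
  also have "\<dots> = (\<Sum>(u, v)\<in>edge_pairs E. p\<^sup>2)"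
  proof (intro sum.cong refl, clarify)
    fix u v assume "(u, v) \<in> edge_pairs E"
    hence uv: "u \<in> {1..n}" "v \<in> {1..n}" "u \<noteq> v"
      using edge_pairs_subset[OF E] by (auto simp: edge_pairs_def)
    have "measure_pmf.expectation (coupled n p) (\<lambda>f. coupled_bern u f * coupled_bern v f) =
        measure_pmf.expectation (coupled n p) (indicator {f. f u \<in> {z. snd z} \<and> f v \<in> {z. snd z}})"
      by (intro Bochner_Integration.integral_cong) (auto simp: indicator_def)
    also have "\<dots> = p\<^sup>2"
      using uv p unfolding coupled_def
      by (simp add: measure_Pi_pmf_two[where A = "{z. snd z}" and B = "{z. snd z}", simplified]
          prob_coupled_bern power2_eq_square)
    finally show "measure_pmf.expectation (coupled n p) (\<lambda>f. coupled_bern u f * coupled_bern v f) = p\<^sup>2" .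
  qed
  finally show ?thesis by simp
qed

text \<open>Two products can differ only if one factor differs while the other Bernoulli variable is \<open>1\<close>:
  if that variable vanishes, so does the Poisson variable coupled to it. This gains the extra
  factor \<open>p\<close> over the mean number of edges.\<close>

lemma prob_coupled_differ:
  fixes p :: real
  assumes E: "is_simple_graph n E" and p: "0 < p" "p < 1"
  shows "measure_pmf.prob (coupled n p)
      {f. edge_poly E (\<lambda>u. coupled_pois u f) \<noteq> edge_poly E (\<lambda>u. coupled_bern u f)}
    \<le> card (edge_pairs E) * (2 * p ^ 3)"
proof -
  let ?D = "edge_pairs E" and ?N = "{(k, b). k \<noteq> of_bool b} :: (nat \<times> bool) set"
  let ?S = "\<lambda>(u, v). {f. f u \<in> ?N \<and> f v \<in> {z. snd z}} \<union> {f. f v \<in> ?N \<and> f u \<in> {z. snd z}}"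
  \<comment> \<open>The inclusion is claimed almost surely because it relies on the support of the
    coupling: off it, a positive count may come with \<open>False\<close>.\<close>
  have "AE f in coupled n p.
      f \<in> {f. edge_poly E (\<lambda>u. coupled_pois u f) \<noteq> edge_poly E (\<lambda>u. coupled_bern u f)} \<longrightarrow>
      f \<in> (\<Union>z\<in>?D. ?S z)"
  proof (simp only: AE_measure_pmf_iff, intro ballI impI, rule ccontr)
    fix f assume f: "f \<in> set_pmf (coupled n p)"
      and ne: "f \<in> {f. edge_poly E (\<lambda>u. coupled_pois u f) \<noteq> edge_poly E (\<lambda>u. coupled_bern u f)}"
      and notin: "f \<notin> (\<Union>z\<in>?D. ?S z)"
    have supp: "snd (f u)" if "u \<in> {1..n}" "fst (f u) > 0" for u
    proof -
      have "f u \<in> set_pmf (pois_bernoulli p)"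
        using f that(1) by (auto simp: coupled_def set_Pi_pmf PiE_dflt_def)
      thus ?thesis using pois_bernoulli_support[of p "fst (f u)" "snd (f u)"] p that by simp
    qed
    have "edge_poly E (\<lambda>u. coupled_pois u f) = edge_poly E (\<lambda>u. coupled_bern u f)"
      unfolding edge_poly_def
    proof (intro sum.cong refl, clarify)
      fix u v assume uv: "(u, v) \<in> ?D"
      hence "u \<in> {1..n}" "v \<in> {1..n}" using edge_pairs_subset[OF E] by auto
      note this[THEN supp]
      moreover from uv notin
      have "\<not> (f u \<in> ?N \<and> snd (f v))" "\<not> (f v \<in> ?N \<and> snd (f u))" by fastforce+
      ultimately show "coupled_pois u f * coupled_pois v f = coupled_bern u f * coupled_bern v f"
        by (cases "snd (f u)"; cases "snd (f v)") (auto simp: case_prod_beta)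
    qed
    with ne show False by simp
  qed
  hence "measure_pmf.prob (coupled n p)
      {f. edge_poly E (\<lambda>u. coupled_pois u f) \<noteq> edge_poly E (\<lambda>u. coupled_bern u f)}
    \<le> measure_pmf.prob (coupled n p) (\<Union>z\<in>?D. ?S z)"
    by (rule measure_pmf.finite_measure_mono_AE) simp
  also have "\<dots> \<le> (\<Sum>z\<in>?D. measure_pmf.prob (coupled n p) (?S z))"
    by (rule measure_pmf.finite_measure_subadditive_finite) (use finite_edge_pairs[OF E] in auto)
  also have "\<dots> \<le> (\<Sum>z\<in>?D. 2 * p ^ 3)"
  proof (intro sum_mono, clarify)
    fix u v assume "(u, v) \<in> ?D"
    hence uv: "u \<in> {1..n}" "v \<in> {1..n}" "u \<noteq> v"
      using edge_pairs_subset[OF E] by (auto simp: edge_pairs_def)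
    have *: "measure_pmf.prob (coupled n p) {f. f a \<in> ?N \<and> f b \<in> {z. snd z}} \<le> p ^ 3"
      if "a \<in> {1..n}" "b \<in> {1..n}" "a \<noteq> b" for a b
    proof -
      have "measure_pmf.prob (coupled n p) {f. f a \<in> ?N \<and> f b \<in> {z. snd z}} =
          measure_pmf.prob (pois_bernoulli p) ?N * p"
        unfolding coupled_def using that p by (subst measure_Pi_pmf_two) (auto simp: prob_coupled_bern)
      also have "\<dots> \<le> p\<^sup>2 * p"
        using prob_pois_bernoulli_neq[OF p] p by (intro mult_right_mono) auto
      finally show ?thesis by (simp add: power2_eq_square power3_eq_cube)
    qed
    have "measure_pmf.prob (coupled n p)
        ({f. f u \<in> ?N \<and> f v \<in> {z. snd z}} \<union> {f. f v \<in> ?N \<and> f u \<in> {z. snd z}}) \<le> p ^ 3 + p ^ 3"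
      by (rule order_trans[OF measure_Un_le add_mono[OF * *]]) (use uv in auto)
    thus "measure_pmf.prob (coupled n p)
        ({f. f u \<in> ?N \<and> f v \<in> {z. snd z}} \<union> {f. f v \<in> ?N \<and> f u \<in> {z. snd z}}) \<le> 2 * p ^ 3"
      by simp
  qed
  finally show ?thesis by simp
qed

section \<open>Weak limits\<close>

text \<open>The coupling inequality: the event that \<open>f\<close> is at most \<open>x\<close>
  lies in the union of the same event for \<open>g\<close> and the event that \<open>f\<close> and
  \<open>g\<close> differ, and conversely.\<close>

lemma cdf_distr_diff_le:
  "\<bar>cdf (distr (measure_pmf q) borel f) x - cdf (distr (measure_pmf q) borel g) x\<bar>
    \<le> measure_pmf.prob q {z. f z \<noteq> g z}"
proof -
  have *: "measure_pmf.prob q {z. f z \<le> x} \<le> measure_pmf.prob q {z. g z \<le> x} +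
      measure_pmf.prob q {z. f z \<noteq> g z}" for f g :: "'a \<Rightarrow> real"
    by (rule order_trans[OF measure_pmf.finite_measure_mono measure_Un_le]) auto
  show ?thesis
    using *[of f g] *[of g f] by (simp add: cdf_def measure_distr vimage_def abs_le_iff eq_commute)
qed

text \<open>The distance to the closed set of naturals, cut off at 1, is a bounded continuous test
  function. Its integral is 0 along the sequence, hence 0 in the limit, so \<open>L\<close> lives on
  the naturals. This supplies the \<open>nat pmf\<close> behind the law of \<open>T\<close>.\<close>

lemma weak_conv_m_nat_valued:
  fixes \<mu> :: "nat \<Rightarrow> real measure"
  assumes "\<And>n. real_distribution (\<mu> n)" "real_distribution L" "weak_conv_m \<mu> L"
    and nat: "\<And>n. AE x in \<mu> n. x \<in> \<nat>"
  obtains q where "L = real_law q"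
proof -
  interpret L: real_distribution L by fact
  define f where "f x = min 1 (infdist x (\<nat> :: real set))" for x :: real
  have cl: "closed (\<nat> :: real set)" using closed_subset_Ints[OF Nats_subset_Ints] .
  have ne: "(\<nat> :: real set) \<noteq> {}" using Nats_0 by blast
  have f0: "f x = 0 \<longleftrightarrow> x \<in> \<nat>" for x
    using in_closed_iff_infdist_zero[OF cl ne] by (auto simp: f_def min_def)
  have f_nonneg: "0 \<le> f x" for x by (simp add: f_def infdist_nonneg)
  have contf: "isCont f x" for x unfolding f_def by (intro continuous_intros)
  hence [measurable]: "f \<in> borel_measurable borel"
    by (intro borel_measurable_continuous_onI continuous_at_imp_continuous_on) auto
  have bdd: "norm (f x) \<le> 1" for x using f_nonneg[of x] by (simp add: f_def)
  have "(\<lambda>n. integral\<^sup>L (\<mu> n) f) \<longlonglongrightarrow> integral\<^sup>L L f"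
    by (rule weak_conv_imp_integral_bdd_continuous_conv) (use assms contf bdd in auto)
  moreover have "integral\<^sup>L (\<mu> n) f = 0" for n
  proof (rule integral_eq_zero_AE)
    show "AE x in \<mu> n. f x = 0" using nat[of n] f0 by simp
  qed
  ultimately have "integral\<^sup>L L f = 0" using LIMSEQ_unique[of "\<lambda>_. 0"] by auto
  moreover have "integrable L f"
    by (rule L.integrable_const_bound[where B = 1]) (use bdd in auto)
  ultimately have "AE x in L. f x = 0"
    using integral_nonneg_eq_0_iff_AE[of L f] f_nonneg by auto
  hence AE_nat: "AE x in L. x \<in> \<nat>" using f0 by simp
  \<comment> \<open>On the naturals \<open>real\<close> undoes \<open>h\<close>, so pushing
    \<open>L\<close> forward by \<open>h\<close> and back by \<open>real\<close> returns
    \<open>L\<close>.\<close>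
  define h where "h x = nat \<lfloor>x\<rfloor>" for x :: real
  have h[measurable]: "h \<in> measurable borel (count_space UNIV)" unfolding h_def by measurable
  define Q where "Q = distr L (count_space UNIV) h"
  have hL: "h \<in> measurable L (count_space UNIV)" using h by simp
  interpret Q: prob_space Q unfolding Q_def using hL by (rule L.prob_space_distr)
  have "measure_pmf (Abs_pmf Q) = Q"
  proof (rule Abs_pmf_inverse, unfold mem_Collect_eq, intro conjI)
    show "prob_space Q" by (rule Q.prob_space_axioms)
    show "sets Q = UNIV" by (simp add: Q_def)
    show "AE x in Q. measure Q {x} \<noteq> 0"
      by (subst Q.AE_support_countable) (auto simp: Q_def intro!: exI[of _ UNIV])
  qed
  hence "real_law (Abs_pmf Q) = distr L borel (\<lambda>x. real (h x))"
    unfolding real_law_def Q_def using hL by (simp add: distr_distr comp_def)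
  also have "\<dots> = distr L borel (\<lambda>x. x)"
  proof (rule distr_cong_AE)
    show "AE x in L. real (h x) = x" using AE_nat by eventually_elim (auto simp: h_def elim: Nats_cases)
  qed (use hL in auto)
  also have "\<dots> = L" by (simp add: distr_id2)
  finally show ?thesis using that by metis
qed

section \<open>Block graphons\<close>

text \<open>Half-open intervals keep neighbouring blocks disjoint, and the length \<open>p\<close>
  makes the number of points in a block Pois(p).\<close>

definition block :: "real \<Rightarrow> nat \<Rightarrow> real set" where
  "block p i = {real i * p..<real (Suc i) * p}"

lemma sets_block [measurable]: "block p i \<in> sets borel"
  by (simp add: block_def)

lemma block_nonneg: "0 < p \<Longrightarrow> block p i \<subseteq> {0..}"
  unfolding block_def by (auto intro: order_trans[rotated])

lemma emeasure_block: "0 < p \<Longrightarrow> emeasure lborel (block p i) = ennreal p"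
  unfolding block_def by (subst emeasure_lborel_Ico) (auto simp: algebra_simps)

lemma block_disjoint:
  assumes "0 < p" "x \<in> block p i" "x \<in> block p j"
  shows "i = j"
proof (rule ccontr)
  have *: False if "i < j" "x \<in> block p i" "x \<in> block p j" for i j
  proof -
    have "real (Suc i) * p \<le> real j * p"
      using that(1) assms(1) by (intro mult_right_mono) auto
    thus False using that by (simp add: block_def)
  qed
  assume "i \<noteq> j"
  thus False using *[of i j] *[of j i] assms by linarith
qed

lemma disjoint_family_block: "0 < p \<Longrightarrow> disjoint_family_on (block p) I"
  using block_disjoint unfolding disjoint_family_on_def by blast

lemma finite_borel_block: "0 < p \<Longrightarrow> finite_borel (block p i)"
  by (simp add: finite_borel_def block_nonneg emeasure_block)

lemma sets_halfline_block: "0 < p \<Longrightarrow> block p i \<in> sets halfline"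
  using block_nonneg by (simp add: sets_restrict_space_iff)

lemma emeasure_halfline_block: "0 < p \<Longrightarrow> emeasure halfline (block p i) = ennreal p"
  using block_nonneg by (simp add: emeasure_restrict_space emeasure_block)

lemma sigma_finite_halfline: "sigma_finite_measure halfline"
  by (rule sigma_finite_measure_restrict_space) (auto intro: lborel.sigma_finite_measure_axioms)

interpretation quadrant: pair_sigma_finite halfline halfline
  by (intro pair_sigma_finite.intro sigma_finite_halfline)

text \<open>The sums start at 0 to match the index range of \<open>is_stoch_integral2\<close>. For a
  simple graph on \<open>{1..n}\<close>, block 0 meets no edge.\<close>

definition block_graphon :: "nat \<Rightarrow> nat set set \<Rightarrow> real \<Rightarrow> real \<Rightarrow> real \<Rightarrow> real" where
  "block_graphon n E p x y = (\<Sum>i<Suc n. \<Sum>j<Suc n.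
     adj E i j * indicator (block p i) x * indicator (block p j) y)"

text \<open>Each coordinate lies in at most one block, so at most one term of the double sum
  survives, and it is an adjacency entry.\<close>

lemma block_graphon_cases:
  assumes "0 < p"
  shows "block_graphon n E p x y \<in> {0, 1}"
proof -
  have *: "\<exists>k. \<forall>i. i < Suc n \<longrightarrow> indicator (block p i) z = (of_bool (i = k) :: real)" for z
  proof (cases "\<exists>k. z \<in> block p k")
    case True
    then obtain k where "z \<in> block p k" by blast
    thus ?thesis using block_disjoint[OF assms] by (intro exI[of _ k]) (auto simp: indicator_def)
  next
    case False
    \<comment> \<open>A point outside all blocks gets the dummy index \<open>Suc n\<close>, which
      lies beyond the range of the sums.\<close>
    thus ?thesis by (intro exI[of _ "Suc n"]) auto
  qed
  obtain k l where
    k: "\<And>i. i < Suc n \<Longrightarrow> indicator (block p i) x = (of_bool (i = k) :: real)" and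
    l: "\<And>i. i < Suc n \<Longrightarrow> indicator (block p i) y = (of_bool (i = l) :: real)"
    using *[of x] *[of y] by blast
  have "block_graphon n E p x y =
      (\<Sum>i<Suc n. \<Sum>j<Suc n. if i = k then if j = l then adj E i j else 0 else 0)"
    unfolding block_graphon_def by (intro sum.cong refl) (simp add: k l)
  also have "\<dots> = (\<Sum>i<Suc n. if i = k then \<Sum>j<Suc n. if j = l then adj E i j else 0 else 0)"
    by (intro sum.cong) auto
  also have "\<dots> = (if k < Suc n \<and> l < Suc n then adj E k l else 0)"
    by (simp only: sum.delta finite_lessThan lessThan_iff) auto
  finally show ?thesis by (auto simp: adj_def)
qed

lemma block_graphon_commute: "block_graphon n E p x y = block_graphon n E p y x"
  unfolding block_graphon_def
  by (subst sum.swap) (auto intro!: sum.cong simp: adj_commute mult_ac)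

lemma integrable_block_graphon:
  assumes "0 < p"
  shows "integrable quadrant (\<lambda>(x, y). block_graphon n E p x y)"
proof -
  have "integrable quadrant (indicator (block p i \<times> block p j) :: real \<times> real \<Rightarrow> real)" for i j
    using assms by (intro integrable_real_indicator pair_measureI sets_halfline_block)
      (simp_all add: sigma_finite_measure.emeasure_pair_measure_Times[OF sigma_finite_halfline]
         sets_halfline_block
         emeasure_halfline_block ennreal_mult[symmetric])
  hence "integrable quadrant (\<lambda>z. \<Sum>i<Suc n. \<Sum>j<Suc n.
      adj E i j * indicator (block p i \<times> block p j) z)"
    by (intro Bochner_Integration.integrable_sum integrable_mult_right)
  thus ?thesis
    by (simp add: block_graphon_def case_prod_unfold indicator_times mult.assoc del: sum.lessThan_Suc)
qed

lemma integrable_block_graphon_section: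
  assumes "0 < p"
  shows "integrable halfline (block_graphon n E p x)"
proof -
  have "integrable halfline (indicator (block p j) :: real \<Rightarrow> real)" for j
    using assms by (intro integrable_real_indicator)
      (simp_all add: sets_halfline_block emeasure_halfline_block)
  thus ?thesis unfolding block_graphon_def[abs_def]
    by (intro Bochner_Integration.integrable_sum integrable_mult_right)
qed

text \<open>The logarithm is 0 where the graphon is 0 and \<open>- t\<close> where it is 1. Hence
  \<open>phi\<close> is a step function and its stochastic integral is a finite sum.\<close>

lemma phi_block_graphon:
  assumes "0 < p"
  shows "phi (block_graphon n E p) t x y = - t * block_graphon n E p x y"
  using block_graphon_cases[OF assms, of n E x y] by (auto simp: phi_def)

section \<open>Block counts of the Poisson process and membership in \<open>P_class\<close>\<close>

context poisson_process
begin

abbreviation block_count :: "real \<Rightarrow> nat \<Rightarrow> 'w \<Rightarrow> real" where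
  "block_count p i \<omega> \<equiv> real (num_points pts (block p i) \<omega>)"

lemma indep_block_count:
  assumes "0 < p" "finite I"
  shows "indep_vars (\<lambda>_. borel) (block_count p) I"
  by (rule indep_vars_compose2[OF indep_num_points])
    (use assms in \<open>auto intro: finite_borel_block disjoint_family_block\<close>)

lemma distr_block_count:
  assumes "0 < p"
  shows "distr P borel (block_count p i) = distr (poisson_pmf p) borel real"
proof -
  note fb = finite_borel_block[OF assms, of i]
  have "distr P borel (block_count p i) =
      distr (distr P (count_space UNIV) (num_points pts (block p i))) borel real"
    by (subst distr_distr[OF _ measurable_num_points[OF fb]]) (auto simp: comp_def)
  also have "measure lborel (block p i) = p"
    using assms by (simp add: measure_def emeasure_block)
  hence "distr P (count_space UNIV) (num_points pts (block p i)) = poisson_pmf p"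
    using assms by (simp add: distr_num_points[OF fb] pois_def)
  finally show ?thesis .
qed

lemma measurable_block_count:
  "0 < p \<Longrightarrow> block_count p i \<in> borel_measurable P"
  by (rule measurable_compose[OF measurable_num_points[OF finite_borel_block]]) auto

lemma integrable_block_count:
  assumes "0 < p"
  shows "integrable P (block_count p i)"
proof -
  have "integrable (distr (poisson_pmf p) borel real) (\<lambda>x. x)"
    using integrable_poisson_pmf_real[OF assms] by (subst integrable_distr_eq) auto
  thus ?thesis
    unfolding distr_block_count[OF assms, symmetric, of i]
    using measurable_block_count[OF assms] by (subst (asm) integrable_distr_eq) auto
qed

lemma integrable_block_count_mult:
  assumes "0 < p" "i \<noteq> j"
  shows "integrable P (\<lambda>\<omega>. block_count p i \<omega> * block_count p j \<omega>)"
proof -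
  have "integrable P (\<lambda>\<omega>. \<Prod>k\<in>{i, j}. block_count p k \<omega>)"
    by (rule indep_vars_integrable)
      (use assms in \<open>auto intro: indep_block_count integrable_block_count\<close>)
  thus ?thesis using assms by simp
qed

end

text \<open>Built on the coupling, so that it can be compared with the Bernoulli count on one space,
  and with values in \<open>nat\<close>, as \<open>P_class\<close> demands.\<close>

definition pois_edge_law :: "nat \<Rightarrow> nat set set \<Rightarrow> real \<Rightarrow> nat pmf" where
  "pois_edge_law n E p =
     map_pmf (\<lambda>f. \<Sum>(u, v)\<in>edge_pairs E. fst (f u) * fst (f v)) (coupled n p)"

lemma real_law_pois_edge_law:
  "real_law (pois_edge_law n E p) =
   distr (coupled n p) borel (\<lambda>f. edge_poly E (\<lambda>u. coupled_pois u f))"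
  unfolding real_law_def pois_edge_law_def edge_poly_def
  by (subst distr_measure_pmf_comp[symmetric]) (simp add: case_prod_beta)

text \<open>Links the coupling to the process \<open>pts\<close>: the first components and the block
  counts are both independent Pois(p) families.\<close>

lemma (in poisson_process) pois_edge_law_eq:
  assumes E: "is_simple_graph n E" and n: "n \<ge> 1" and p: "0 < p" "p < 1"
  shows "real_law (pois_edge_law n E p) =
    distr P borel (\<lambda>\<omega>. edge_poly E (\<lambda>u. block_count p u \<omega>))"
proof -
  have "distr (coupled n p) borel (coupled_pois u) = distr P borel (block_count p u)"
    if "u \<in> {1..n}" for u
    using that distr_coupled[OF that, of p "\<lambda>z. real (fst z)"]
    by (simp add: distr_block_count distr_measure_pmf_comp map_fst_pois_bernoulli p)
  thus ?thesis unfolding real_law_pois_edge_law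
    by (intro distr_edge_poly_cong[OF E measure_pmf.prob_space_axioms prob_space_axioms n
          indep_coupled indep_block_count]) (use p in auto)
qed

lemma (in poisson_process) pois_edge_law_in_P_class:
  assumes E: "is_simple_graph n E" and n: "n \<ge> 1" and p: "0 < p" "p < 1"
  shows "pois_edge_law n E p \<in> P_class P pts"
proof -
  let ?W = "block_graphon n E p" and ?Q = "\<lambda>\<omega>. edge_poly E (\<lambda>u. block_count p u \<omega>)"
  \<comment> \<open>This choice makes \<open>Delta\<close> vanish, so the second summand is 0, which
    explains the second component of \<open>\<rho>\<close>.\<close>
  define d where "d x = (LINT y|halfline. ?W x y)" for x
  define \<rho> where "\<rho> = map_pmf (\<lambda>j. (j, 0::nat)) (pois_edge_law n E p)"
  have W01: "0 \<le> ?W x y \<and> ?W x y \<le> 1" for x y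
    using block_graphon_cases[OF p(1), of n E x y] by auto
  have "?W \<in> W_class"
    using borel_measurable_integrable[OF integrable_block_graphon[OF p(1), of n E]] W01
    by (auto simp: W_class_def intro: block_graphon_commute)
  moreover have "d \<in> F_class"
    using quadrant.integrable_fst'[OF integrable_block_graphon[OF p(1), of n E]] W01
    by (auto simp: F_class_def d_def[abs_def] intro!: integral_nonneg_AE)
  moreover have "pois_edge_law n E p = map_pmf (\<lambda>(j1, j2). j1 + j2) \<rho>"
    by (simp add: \<rho>_def map_pmf_comp)
  moreover have Delta0: "Delta ?W d = (\<lambda>x. 0)"
    by (simp add: Delta_def d_def fun_eq_iff)
  moreover have meas: "?Q \<in> borel_measurable P"
    unfolding edge_poly_def case_prod_beta
    by (intro borel_measurable_sum borel_measurable_times measurable_block_count p)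
  have double: "(\<Sum>i<Suc n. \<Sum>j<Suc n. c * adj E i j * block_count p i \<omega> * block_count p j \<omega>)
      = 2 * c * ?Q \<omega>" for c \<omega>
  proof -
    have "{1..n} \<subseteq> {..<Suc n}" by auto
    from half_adj_sum[OF E finite_lessThan this, of "\<lambda>u. block_count p u \<omega>"]
    have "(\<Sum>i<Suc n. \<Sum>j<Suc n. adj E i j * block_count p i \<omega> * block_count p j \<omega>) = 2 * ?Q \<omega>"
      by (simp only: edge_poly_def)
    thus ?thesis by (simp add: mult.assoc sum_distrib_left[symmetric] del: sum.lessThan_Suc)
  qed
  \<comment> \<open>The integrand is already elementary, with zero diagonal since the graph has no
    loops, so a constant sequence approximates it. The factor 2 counts both orientations of an edge
    and cancels the 1/2 in the exponent.\<close>
  have "is_stoch_integral2 P pts (phi ?W t) (\<lambda>\<omega>. - 2 * t * ?Q \<omega>)" for t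
    unfolding is_stoch_integral2_def
  proof (rule exI[of _ "\<lambda>_. Suc n"], rule exI[of _ "\<lambda>_. block p"],
      rule exI[of _ "\<lambda>_ i j. - t * adj E i j"], intro exI conjI allI)
    show "disjoint_borel (Suc n) (block p)"
      using p by (simp add: disjoint_borel_def block_nonneg disjoint_family_block)
    show "i < Suc n \<longrightarrow> (- t) * adj E i i = 0" for i
      using adj_self[OF E] by simp
    show "L1_limit quadrant (\<lambda>_. \<lambda>(x, y). \<Sum>i<Suc n. \<Sum>j<Suc n.
        - t * adj E i j * indicator (block p i) x * indicator (block p j) y)
        (\<lambda>(x, y). phi ?W t x y)"
    proof -
      have "(\<lambda>(x, y). \<Sum>i<Suc n. \<Sum>j<Suc n.
          - t * adj E i j * indicator (block p i) x * indicator (block p j) y) =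
          (\<lambda>(x, y). phi ?W t x y)"
        by (simp add: phi_block_graphon[OF p(1)] block_graphon_def sum_distrib_left
            sum_negf mult.assoc del: sum.lessThan_Suc)
      moreover have "integrable quadrant (\<lambda>(x, y). phi ?W t x y)"
        using integrable_mult_right[OF integrable_block_graphon[OF p(1), of n E], of "- t"]
        by (simp add: phi_block_graphon[OF p(1)] case_prod_unfold)
      ultimately show ?thesis by (simp add: L1_limit_def del: sum.lessThan_Suc)
    qed
    show "L1_limit P (\<lambda>_. \<lambda>\<omega>. \<Sum>i<Suc n. \<Sum>j<Suc n.
        - t * adj E i j * block_count p i \<omega> * block_count p j \<omega>) (\<lambda>\<omega>. - 2 * t * ?Q \<omega>)"
    proof -
      have "integrable P ?Q"
        unfolding edge_poly_def case_prod_beta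
        by (intro Bochner_Integration.integrable_sum integrable_block_count_mult p)
           (auto simp: edge_pairs_def)
      thus ?thesis unfolding double by (simp add: L1_limit_def)
    qed
  qed (rule refl)+
  \<comment> \<open>Empty sums, with \<open>m = 0\<close>, represent the zero integrand.\<close>
  moreover have "is_stoch_integral1 P pts (Delta ?W d) (\<lambda>\<omega>. 0)"
    unfolding is_stoch_integral1_def Delta0
    by (rule exI[of _ "\<lambda>_. 0"], rule exI[of _ "\<lambda>_ _. {}"], rule exI[of _ "\<lambda>_ _. 0"],
        rule exI[of _ "\<lambda>_ _. 0"], rule exI[of _ "\<lambda>_ _. 0"])
       (simp add: disjoint_borel_def L1_limit_def disjoint_family_on_def)
  \<comment> \<open>Both sides are the Laplace transform at \<open>t1\<close> of the same edge count
    law.\<close>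
  moreover have "measure_pmf.expectation \<rho> (\<lambda>(j1, j2). exp (- t1 * real j1 - t2 * real j2)) =
      (LINT \<omega>|P. exp (1/2 * (- 2 * t1 * ?Q \<omega>) - (1 - exp (- t2)) * 0))" for t1 t2
  proof -
    have "measure_pmf.expectation \<rho> (\<lambda>(j1, j2). exp (- t1 * real j1 - t2 * real j2)) =
        integral\<^sup>L (real_law (pois_edge_law n E p)) (\<lambda>x. exp (- t1 * x))"
      unfolding real_law_def by (subst integral_distr) (auto simp: \<rho>_def)
    also have "\<dots> = (LINT \<omega>|P. exp (- t1 * ?Q \<omega>))"
      unfolding pois_edge_law_eq[OF E n p] using meas by (subst integral_distr) auto
    finally show ?thesis by simp
  qed
  ultimately show ?thesis
    unfolding P_class_def mem_Collect_eq
    using integrable_block_graphon[OF p(1), of n E] integrable_block_graphon_section[OF p(1), of n E]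
    by (intro exI[of _ \<rho>] bexI[of _ ?W] bexI[of _ d] conjI allI impI) (auto intro!: exI)
qed

section \<open>Passage to the limit\<close>

theorem mainTheorem2:
  fixes P :: "'w measure" and pts :: "'w \<Rightarrow> real set"
    and M :: "nat \<Rightarrow> 'a measure" and X :: "nat \<Rightarrow> nat \<Rightarrow> 'a \<Rightarrow> real"
    and p :: "nat \<Rightarrow> real" and E :: "nat \<Rightarrow> nat set set"
    and M' :: "'b measure" and T :: "'b \<Rightarrow> real"
  assumes "poisson_process P pts"
    and "\<And>n. n \<ge> 1 \<Longrightarrow> 0 < p n \<and> p n < 1"
    and "p \<longlonglongrightarrow> 0"
    and "\<And>n. n \<ge> 1 \<Longrightarrow> prob_space (M n)"
    and "\<And>n. n \<ge> 1 \<Longrightarrow> iid_bernoulli (M n) n (p n) (X n)"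
    and "\<And>n. n \<ge> 1 \<Longrightarrow> is_simple_graph n (E n)"
    and "(\<lambda>n. prob_space.expectation (M n) (edge_count n (E n) (X n))) \<in> \<Theta>(\<lambda>_. 1)"
    and "prob_space M'" and "T \<in> borel_measurable M'"
    and "weak_conv_m (\<lambda>n. distr (M n) borel (edge_count n (E n) (X n))) (distr M' borel T)"
  shows "\<exists>\<mu>\<in>P_closure P pts. \<exists>r\<ge>0.
    distr M' borel T =
    distr (measure_pmf (pair_pmf \<mu> (pois r))) borel (\<lambda>(j, j0). real j + real j0)"
proof -
  interpret poisson_process P pts by fact
  let ?L = "distr M' borel T"
  let ?T = "\<lambda>n. distr (M n) borel (edge_count n (E n) (X n))"
  let ?ET = "\<lambda>n. prob_space.expectation (M n) (edge_count n (E n) (X n))"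
  \<comment> \<open>The index is shifted because the hypotheses start at 1, while every member of
    the sequence in \<open>P_closure\<close> must lie in \<open>P_class\<close>.\<close>
  define \<nu> where "\<nu> n = pois_edge_law (Suc n) (E (Suc n)) (p (Suc n))" for n
  have cdf_diff: "\<bar>cdf (real_law (pois_edge_law n (E n) (p n))) x - cdf (?T n) x\<bar>
      \<le> 2 * p n * ?ET n" if n: "n \<ge> 1" for n x
  proof -
    note * = assms(6)[OF n] n assms(2)[OF n, THEN conjunct1] assms(2)[OF n, THEN conjunct2]
      assms(4)[OF n] assms(5)[OF n]
    show ?thesis
      unfolding real_law_pois_edge_law edge_count_law[OF *] expectation_edge_count[OF *]
      by (rule order_trans[OF cdf_distr_diff_le order_trans[OF prob_coupled_differ]])
         (use * in \<open>auto simp: power2_eq_square power3_eq_cube\<close>)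
  qed
  \<comment> \<open>A null sequence times a bounded one.\<close>
  have lim0: "(\<lambda>n. 2 * p n * ?ET n) \<longlonglongrightarrow> 0"
  proof -
    have "p \<in> o(\<lambda>_. 1)" using assms(3) by (intro smalloI_tendsto) auto
    moreover have "?ET \<in> O(\<lambda>_. 1)" using assms(7) by (rule bigthetaD1)
    ultimately have "(\<lambda>n. p n * ?ET n) \<in> o(\<lambda>_. 1 * 1)" by (rule landau_o.small_big_mult)
    hence "(\<lambda>n. p n * ?ET n) \<longlonglongrightarrow> 0" using smalloD_tendsto by fastforce
    thus ?thesis using tendsto_mult_right_zero[of _ _ 2] by (simp add: mult.assoc)
  qed
  have conv: "weak_conv_m (\<lambda>n. real_law (\<nu> n)) ?L"
    unfolding weak_conv_m_def weak_conv_def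
  proof (intro allI impI)
    fix x assume "isCont (cdf ?L) x"
    hence T: "(\<lambda>n. cdf (?T n) x) \<longlonglongrightarrow> cdf ?L x"
      using assms(10) by (simp add: weak_conv_m_def weak_conv_def)
    have "(\<lambda>n. cdf (real_law (pois_edge_law n (E n) (p n))) x - cdf (?T n) x) \<longlonglongrightarrow> 0"
      by (rule Lim_null_comparison[OF _ lim0])
         (use cdf_diff in \<open>auto intro!: eventually_sequentiallyI[of 1]\<close>)
    from tendsto_add[OF this T]
    show "(\<lambda>n. cdf (real_law (\<nu> n)) x) \<longlonglongrightarrow> cdf ?L x"
      unfolding \<nu>_def
      by (intro LIMSEQ_Suc[where f = "\<lambda>n. cdf (real_law (pois_edge_law n (E n) (p n))) x"]) simp
  qed
  have "real_distribution (real_law (\<nu> n))" for n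
    unfolding real_law_def by (rule prob_space.real_distribution_distr[OF measure_pmf.prob_space_axioms]) simp
  moreover have "real_distribution ?L"
    by (rule prob_space.real_distribution_distr) (use assms in auto)
  moreover have "AE x in real_law (\<nu> n). x \<in> \<nat>" for n
    unfolding real_law_def by (subst AE_distr_iff) auto
  ultimately obtain \<mu> where \<mu>: "?L = real_law \<mu>"
    using conv weak_conv_m_nat_valued by metis
  have "\<nu> n \<in> P_class P pts" for n
    unfolding \<nu>_def by (rule pois_edge_law_in_P_class) (use assms(2,6) in auto)
  hence "\<mu> \<in> P_closure P pts"
    using conv \<mu> by (auto simp: P_closure_def)
  \<comment> \<open>\<open>pois 0\<close> is the point mass at 0, so the added summand
    vanishes.\<close>
  moreover have "?L = distr (pair_pmf \<mu> (pois 0)) borel (\<lambda>(j, j0). real j + real j0)"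
    unfolding \<mu> real_law_def
    by (simp add: pois_def pair_return_pmf2 distr_measure_pmf_comp[symmetric])
  ultimately show ?thesis by (intro bexI[of _ \<mu>] exI[of _ 0]) auto
qed

end
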